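(* Let $\mathcal{P}$ be the set of integer partitions satisfying all of the following: (i) no part repeats; (ii) adjacent parts do not differ by $1$ if the larger of the two is even; (iii) for every integer $j$, none of $(2j)+(2j+1)+(2j+3)$, $(2j)+(2j+2)+(2j+3)$, $(2j)+(2j+2)+(2j+4)$ occurs as a sub-partition; (iv) none of $1+3$, $2+3$, $2+4$ occurs as a sub-partition. Then, as formal power series in $q$, $$\sum_{\pi\in\mathcal{P}}q^{|\pi|}=\sum_{i,j,k\ge 0}(-1)^k\frac{q^{i^2+4ij+6ik+4j^2+12jk+12k^2+i-3j}}{(q;q)_i\,(q^4;q^4)_j\,(q^6;q^6)_k}.$$
   Context: Partitions are finite weakly increasing sequences of positive integers (the empty partition is included); $|\pi|$ is the sum of the parts of $\pi$. A sub-partition of a partition is a contiguous portion of it. For $n\ge 0$, $(a;q)_n=\prod_{0\le t<n}(1-aq^t)$. All identities are identities of formal power series. *)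

theory Defs
  imports
    "HOL-Analysis.Infinite_Sum"
    "HOL-Computational_Algebra.Formal_Power_Series"
    "HOL-Library.Sublist"
begin

definition is_partition :: "nat list \<Rightarrow> bool" where
  "is_partition \<pi> \<longleftrightarrow> sorted \<pi> \<and> (\<forall>p \<in> set \<pi>. 0 < p)"

(* "sublist" is the contiguous-sublist relation. Parts are positive, so letting j range over
   the integers instead of the naturals would add no further forbidden pattern. *)
definition P_set :: "nat list set" where
  "P_set = {\<pi>. is_partition \<pi>
     \<and> distinct \<pi>
     \<and> (\<forall>i. Suc i < length \<pi> \<and> even (\<pi> ! Suc i) \<longrightarrow> \<pi> ! Suc i \<noteq> \<pi> ! i + 1)
     \<and> (\<forall>j. \<not> sublist [2 * j, 2 * j + 1, 2 * j + 3] \<pi>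
          \<and> \<not> sublist [2 * j, 2 * j + 2, 2 * j + 3] \<pi>
          \<and> \<not> sublist [2 * j, 2 * j + 2, 2 * j + 4] \<pi>)
     \<and> \<not> sublist [1, 3] \<pi> \<and> \<not> sublist [2, 3] \<pi> \<and> \<not> sublist [2, 4] \<pi>}"

definition qpoch :: "'a::comm_ring_1 \<Rightarrow> 'a \<Rightarrow> nat \<Rightarrow> 'a" where
  "qpoch a q n = (\<Prod>t<n. 1 - a * q ^ t)"

definition expo :: "nat \<Rightarrow> nat \<Rightarrow> nat \<Rightarrow> nat" where
  "expo i j k =
     i\<^sup>2 + 4 * i * j + 6 * i * k + 4 * j\<^sup>2 + 12 * j * k + 12 * k\<^sup>2 + i - 3 * j"

(* The natural-number subtraction in expo never truncates. *)
lemma int_expo: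
  "int (expo i j k) =
     (int i)\<^sup>2 + 4 * int i * int j + 6 * int i * int k + 4 * (int j)\<^sup>2
     + 12 * int j * int k + 12 * (int k)\<^sup>2 + int i - 3 * int j"
proof -
  have "3 * j \<le> 4 * j\<^sup>2"
    by (cases j) (auto simp: power2_eq_square)
  then have "3 * j \<le> i\<^sup>2 + 4 * i * j + 6 * i * k + 4 * j\<^sup>2 + 12 * j * k + 12 * k\<^sup>2 + i"
    by linarith
  then show ?thesis
    by (simp add: expo_def of_nat_diff)
qed

end

(* Let q be fps_X and let Z be the variable of the outer power series ring; [Z^n] denotes a
   coefficient in Z. Condition (iv) says exactly that the partition may be preceded by a
   fictitious part 0. Let N_n, E_n be the generating functions of the partitions with n parts
   satisfying (i)-(iii), respectively (i)-(iv). Splitting off the parts 1 and 2 and subtracting 2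
   from the other parts gives a linear system for N_n, E_n, which is solved by
     E_n = q^(n^2) [Z^n] (1 + (1 + q) Z) K,
     K = (q^9 Z^3; q^6)_inf / ((q^2 Z; q)_inf (q Z^2; q^4)_inf).
   Since the exponent in the triple sum is (i+2j+3k)^2 + 3k^2 + i - 3j, the terms with
   i + 2j + 3k = n add up to r_n = q^(n^2) [Z^n] (q^3 Z^3; q^6)_inf / ((q Z; q)_inf (Z^2 / q^3; q^4)_inf).
   Termwise r_n and E_n differ, but r_n - E_n = M_(n-1) - M_n with M_n = q^(n^2) [Z^(n-1)] W and
   W = (1 - q^2 Z) K, so the sums over n agree. The negative power of q disappears on replacing
   Z by q^2 Z, which turns the product for r_n into W: hence q^(2n) r_n = q^(n^2) [Z^n] W. *)

theory Submission
  imports Defs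
begin

section \<open>Euler products as power series\<close>

text \<open>The substitution of t Z for Z, with Z the variable of the series and t a
  coefficient.\<close>

definition dilate :: "'a::comm_ring_1 \<Rightarrow> 'a fps \<Rightarrow> 'a fps" where
  "dilate t f = Abs_fps (\<lambda>n. t ^ n * fps_nth f n)"

lemma dilate_nth [simp]: "fps_nth (dilate t f) n = t ^ n * fps_nth f n"
  by (simp add: dilate_def)

lemma dilate_mult: "dilate t (f * g) = dilate t f * dilate t g"
proof (rule fps_ext)
  fix n
  have "t ^ n * (fps_nth f i * fps_nth g (n - i)) = t ^ i * fps_nth f i * (t ^ (n - i) * fps_nth g (n - i))"
    if "i \<le> n" for i
  proof -
    have "t ^ n = t ^ i * t ^ (n - i)"
      using that by (simp flip: power_add)
    then show ?thesis by (simp add: mult_ac)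
  qed
  then show "fps_nth (dilate t (f * g)) n = fps_nth (dilate t f * dilate t g) n"
    by (simp add: fps_mult_nth sum_distrib_left)
qed

text \<open>The product $1/(aZ^d;q^p)_\infty$, expanded by Euler's identity.\<close>

definition eul :: "nat \<Rightarrow> nat \<Rightarrow> 'a::field fps \<Rightarrow> 'a fps fps" where
  "eul p d a = Abs_fps (\<lambda>n. if d dvd n
     then a ^ (n div d) / qpoch (fps_X ^ p) (fps_X ^ p) (n div d) else 0)"

text \<open>The product $(cZ^d;q^p)_\infty$.\<close>

definition coeul :: "nat \<Rightarrow> nat \<Rightarrow> 'a::field fps \<Rightarrow> 'a fps fps" where
  "coeul p d c = Abs_fps (\<lambda>n. if d dvd n
     then (- c) ^ (n div d) * fps_X ^ (p * (n div d choose 2)) / qpoch (fps_X ^ p) (fps_X ^ p) (n div d) else 0)"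

lemma qpoch_Suc: "qpoch a q (Suc n) = qpoch a q n * (1 - a * q ^ n)"
  by (simp add: qpoch_def)

lemma qpoch_nth_0: "0 < p \<Longrightarrow> fps_nth (qpoch (fps_X ^ p) (fps_X ^ p) n) 0 = (1 :: 'a::field)"
  by (induction n) (auto simp: qpoch_Suc qpoch_def fps_X_power_nth simp flip: power_add)

text \<open>Brings neighbouring coefficients of an Euler expansion over a common denominator. All
  denominators have constant term 1, so they are units and division is multiplication by the
  inverse.\<close>

lemma div_qpoch_Suc:
  assumes "0 < p"
  shows "f / qpoch (fps_X ^ p) (fps_X ^ p) n
    = (f :: 'a::field fps) * (1 - fps_X ^ (p * Suc n)) / qpoch (fps_X ^ p) (fps_X ^ p) (Suc n)"
proof -
  let ?P = "qpoch (fps_X ^ p) (fps_X ^ p) :: nat \<Rightarrow> 'a fps"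
  let ?u = "1 - fps_X ^ (p * Suc n) :: 'a fps"
  have u: "fps_nth ?u 0 \<noteq> 0" using assms by simp
  have eq: "?P (Suc n) = ?P n * ?u"
    by (simp add: qpoch_Suc power_add power_mult)
  have P: "fps_nth (?P k) 0 \<noteq> 0" for k
    using qpoch_nth_0 [OF assms, of k, where 'a = 'a] by simp
  have "f * ?u / ?P (Suc n) = f * ?u * inverse (?P n * ?u)"
    using P [of "Suc n"] by (simp add: fps_divide_unit eq)
  also have "\<dots> = f * inverse (?P n) * (?u * inverse ?u)"
    by (simp add: fps_inverse_mult mult_ac)
  also have "?u * inverse ?u = 1"
    using u by (rule inverse_mult_eq_1')
  also have "f * inverse (?P n) * 1 = f / ?P n"
    using P [of n] by (simp add: fps_divide_unit)
  finally show ?thesis by simp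
qed

text \<open>Replacing a by a q^p deletes the first factor of the product. As the product exists only
  through its expansion, coefficients are compared: at Z^(d k) the numerator identity is a^k q^(p k)
  = a^k - a^k (1 - q^(p k)), and 1 - q^(p k) cancels the last factor of the denominator.\<close>

lemma eul_step:
  fixes a :: "'a::field fps"
  assumes "0 < p" "0 < d"
  shows "eul p d (a * fps_X ^ p) = (1 - fps_const a * fps_X ^ d) * eul p d a"
proof (rule fps_ext)
  fix n
  let ?P = "qpoch (fps_X ^ p) (fps_X ^ p) :: nat \<Rightarrow> 'a fps"
  have rhs: "fps_nth ((1 - fps_const a * fps_X ^ d) * eul p d a) n
    = fps_nth (eul p d a) n - a * fps_nth (fps_X ^ d * eul p d a) n"
    by (simp add: left_diff_distrib mult.assoc)
  show "fps_nth (eul p d (a * fps_X ^ p)) n = fps_nth ((1 - fps_const a * fps_X ^ d) * eul p d a) n"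
  proof (cases "d dvd n")
    case True
    then obtain k where k: "n = d * k" ..
    show ?thesis
    proof (cases k)
      case 0
      then show ?thesis using assms k unfolding rhs by (simp add: fps_X_power_mult_nth eul_def)
    next
      case (Suc l)
      have "a * (a ^ l / ?P l) = a ^ k * (1 - fps_X ^ (p * k)) / ?P k"
        using div_qpoch_Suc [OF assms(1), of "a ^ k" l] Suc qpoch_nth_0 [OF assms(1), of l, where 'a = 'a]
        by (simp add: fps_divide_unit mult.assoc)
      moreover have "(a * fps_X ^ p) ^ k / ?P k = a ^ k / ?P k - a ^ k * (1 - fps_X ^ (p * k)) / ?P k"
        using qpoch_nth_0 [OF assms(1), of k, where 'a = 'a]
        by (simp add: fps_divide_unit power_mult_distrib algebra_simps flip: power_mult)
      ultimately show ?thesis using assms k Suc unfolding rhs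
        by (simp add: fps_X_power_mult_nth eul_def)
    qed
  next
    case False
    then have "fps_nth (fps_X ^ d * eul p d a) n = 0"
      by (auto simp: fps_X_power_mult_nth eul_def dvd_minus_self)
    then show ?thesis using False unfolding rhs by (simp add: eul_def)
  qed
qed

text \<open>Splits off the first factor of the product, again by coefficients. With k = l + 1, the
  relation binom(k,2) = l + binom(l,2) makes the powers of q agree.\<close>

lemma coeul_step:
  fixes c :: "'a::field fps"
  assumes "0 < p" "0 < d"
  shows "coeul p d c = (1 - fps_const c * fps_X ^ d) * coeul p d (c * fps_X ^ p)"
proof (rule fps_ext)
  fix n
  let ?P = "qpoch (fps_X ^ p) (fps_X ^ p) :: nat \<Rightarrow> 'a fps"
  let ?c = "coeul p d (c * fps_X ^ p)"
  have rhs: "fps_nth ((1 - fps_const c * fps_X ^ d) * ?c) n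
    = fps_nth ?c n - c * fps_nth (fps_X ^ d * ?c) n"
    by (simp add: left_diff_distrib mult.assoc)
  show "fps_nth (coeul p d c) n = fps_nth ((1 - fps_const c * fps_X ^ d) * ?c) n"
  proof (cases "d dvd n")
    case True
    then obtain k where k: "n = d * k" ..
    show ?thesis
    proof (cases k)
      case 0
      then show ?thesis using assms k unfolding rhs by (simp add: fps_X_power_mult_nth coeul_def)
    next
      case (Suc l)
      let ?g = "(- c) ^ k * fps_X ^ (p * (k choose 2))"
      have ch: "k choose 2 = l + (l choose 2)"
        by (simp add: Suc numeral_2_eq_2)
      have g: "(- (c * fps_X ^ p)) ^ k * fps_X ^ (p * (k choose 2)) = ?g * fps_X ^ (p * k)"
        by (simp add: power_mult_distrib power_mult flip: mult_minus_left)
      have "(- (c * fps_X ^ p)) ^ l * fps_X ^ (p * (l choose 2)) = (- c) ^ l * fps_X ^ (p * (k choose 2))"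
        by (simp add: ch power_mult_distrib power_mult power_add distrib_left flip: mult_minus_left)
      then have "c * ((- (c * fps_X ^ p)) ^ l * fps_X ^ (p * (l choose 2)) / ?P l) = - (?g / ?P l)"
        using qpoch_nth_0 [OF assms(1), of l, where 'a = 'a]
        by (simp add: fps_divide_unit mult.assoc Suc)
      also have "\<dots> = - (?g * (1 - fps_X ^ (p * k)) / ?P k)"
        using div_qpoch_Suc [OF assms(1), of ?g l] Suc by simp
      finally have 1: "c * ((- (c * fps_X ^ p)) ^ l * fps_X ^ (p * (l choose 2)) / ?P l)
         = - (?g * (1 - fps_X ^ (p * k)) / ?P k)" .
      have "?g * fps_X ^ (p * k) / ?P k = ?g / ?P k - ?g * (1 - fps_X ^ (p * k)) / ?P k"
        using qpoch_nth_0 [OF assms(1), of k, where 'a = 'a]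
        by (simp add: fps_divide_unit algebra_simps)
      then have "?g / ?P k = (- (c * fps_X ^ p)) ^ k * fps_X ^ (p * (k choose 2)) / ?P k
          - c * ((- (c * fps_X ^ p)) ^ l * fps_X ^ (p * (l choose 2)) / ?P l)"
        unfolding g 1 by simp
      moreover have "n div d = k" "(n - d) div d = l" "d dvd n - d" "\<not> n < d"
        using assms k Suc by auto
      ultimately show ?thesis using True unfolding rhs
        by (simp only: fps_X_power_mult_nth coeul_def fps_nth_Abs_fps if_True if_False)
    qed
  next
    case False
    then have "fps_nth (fps_X ^ d * ?c) n = 0"
      by (auto simp: fps_X_power_mult_nth coeul_def dvd_minus_self)
    then show ?thesis using False unfolding rhs by (simp add: coeul_def)
  qed
qed

lemma dilate_eul: "0 < p \<Longrightarrow> 0 < d \<Longrightarrow> dilate t (eul p d a) = eul p d (a * t ^ d)"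
proof (rule fps_ext)
  fix n
  assume p: "0 < p" and d: "0 < d"
  show "fps_nth (dilate t (eul p d a)) n = fps_nth (eul p d (a * t ^ d)) n"
  proof (cases "d dvd n")
    case True
    then obtain k where k: "n = d * k" ..
    show ?thesis using d qpoch_nth_0 [OF p, of k, where 'a = 'a]
      by (simp add: k eul_def power_mult_distrib power_mult fps_divide_unit mult_ac)
  qed (simp add: eul_def)
qed

lemma dilate_coeul: "0 < p \<Longrightarrow> 0 < d \<Longrightarrow> dilate t (coeul p d c) = coeul p d (c * t ^ d)"
proof (rule fps_ext)
  fix n
  assume p: "0 < p" and d: "0 < d"
  show "fps_nth (dilate t (coeul p d c)) n = fps_nth (coeul p d (c * t ^ d)) n"
  proof (cases "d dvd n")
    case True
    then obtain k where k: "n = d * k" ..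
    have "(- (c * t ^ d)) ^ k = t ^ (d * k) * (- c) ^ k"
      by (subst minus_mult_left) (simp only: power_mult_distrib power_mult mult.commute)
    then show ?thesis using d qpoch_nth_0 [OF p, of k, where 'a = 'a]
      by (simp add: k coeul_def fps_divide_unit mult_ac)
  qed (simp add: coeul_def)
qed


lemma dilate_add: "dilate t (f + g) = dilate t f + dilate t g"
  by (simp add: fps_eq_iff distrib_left)

section \<open>The product series and their functional equations\<close>

abbreviation qz :: "'a::field fps fps" where "qz \<equiv> fps_const fps_X"

text \<open>This is (q^3 Z^3; q^6)_inf / ((Z; q)_inf (q Z^2; q^4)_inf), the product whose
  coefficients turn out to give N_n / q^(n^2). Here \<open>fps_X\<close> is Z at the outer level and
  q inside coefficients; \<open>qz\<close> is q as an outer constant.\<close>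

definition seriesN :: "'a::field fps fps" where
  "seriesN = eul 1 1 1 * eul 4 2 fps_X * coeul 6 3 (fps_X ^ 3)"

definition seriesK :: "'a::field fps fps" where
  "seriesK = eul 1 1 (fps_X ^ 2) * eul 4 2 fps_X * coeul 6 3 (fps_X ^ 9)"

definition seriesE :: "'a::field fps fps" where
  "seriesE = (1 + (1 + qz) * fps_X) * seriesK"

definition seriesW :: "'a::field fps fps" where
  "seriesW = eul 1 1 (fps_X ^ 3) * eul 4 2 fps_X * coeul 6 3 (fps_X ^ 9)"

lemma one_minus_fps_X_neq_0: "1 - fps_const a * fps_X \<noteq> (0 :: 'a::comm_ring_1 fps)"
proof
  assume "1 - fps_const a * fps_X = (0 :: 'a fps)"
  then have "fps_nth (1 - fps_const a * fps_X) 0 = fps_nth (0 :: 'a fps) 0" by (rule arg_cong)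
  then show False by simp
qed

text \<open>The factors 1 - q^3 Z^3 and 1 - q Z by which the products differ have the quotient 1 + q
  Z + q^2 Z^2.\<close>

lemma seriesN_seriesK: "(1 - fps_X) * seriesN = (1 + qz * fps_X + qz ^ 2 * fps_X ^ 2) * seriesK"
proof -
  have 1: "eul 1 1 fps_X = (1 - fps_X) * eul 1 1 (1 :: 'a fps)"
    using eul_step [of 1 1 "1 :: 'a fps"] by simp
  have 2: "eul 1 1 (fps_X ^ 2) = (1 - qz * fps_X) * eul 1 1 (fps_X :: 'a fps)"
    using eul_step [of 1 1 "fps_X :: 'a fps"] by (simp add: power2_eq_square)
  have 3: "coeul 6 3 (fps_X ^ 3) = (1 - qz ^ 3 * fps_X ^ 3) * coeul 6 3 (fps_X ^ 9 :: 'a fps)"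
    using coeul_step [of 6 3 "fps_X ^ 3 :: 'a fps"] by (simp add: fps_const_power flip: power_add)
  \<comment> \<open>The extra factor 1 - q Z lets \<open>eul_step\<close> be used without division;
    it is cancelled afterwards.\<close>
  have "(1 - qz * fps_X) * ((1 - fps_X) * seriesN)
    = (1 - qz * fps_X) * ((1 + qz * fps_X + qz ^ 2 * fps_X ^ 2) * (seriesK :: 'a fps fps))"
    unfolding seriesN_def seriesK_def 1 2 3 by algebra
  then show ?thesis
    using one_minus_fps_X_neq_0 [of "fps_X :: 'a fps"] by (simp only: mult_cancel_left simp_thms)
qed

text \<open>Under Z := q^2 Z the first and third products become those of \<open>seriesK\<close>;
  the middle one only loses its first factor, 1 / (1 - q Z^2).\<close>

lemma dilate_seriesN: "dilate (fps_X ^ 2) seriesN = (1 - qz * fps_X ^ 2) * seriesK"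
proof -
  have "eul 4 2 (fps_X ^ 5) = (1 - qz * fps_X ^ 2) * eul 4 2 (fps_X :: 'a fps)"
    using eul_step [of 4 2 "fps_X :: 'a fps"] by (simp flip: power_Suc)
  then show ?thesis
    by (simp add: seriesN_def seriesK_def dilate_mult dilate_eul dilate_coeul mult_ac
        flip: power_mult power_add power_Suc)
qed

lemma seriesW_seriesK: "seriesW = (1 - qz ^ 2 * fps_X) * seriesK"
  using eul_step [of 1 1 "fps_X ^ 2 :: 'a fps"]
  by (simp add: seriesW_def seriesK_def fps_const_power mult_ac flip: power_Suc)

text \<open>The same cancellation as for \<open>seriesN_seriesK\<close>, now through 1 - q^9 Z^3 =
  (1 - q^3 Z) (1 + q^3 Z + q^6 Z^2).\<close>

lemma dilate_seriesK:
  "(1 - qz * fps_X ^ 2) * seriesW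
    = (1 + qz ^ 3 * fps_X + qz ^ 6 * fps_X ^ 2) * dilate (fps_X ^ 2) seriesK"
proof -
  have 1: "eul 1 1 (fps_X ^ 4) = (1 - qz ^ 3 * fps_X) * eul 1 1 (fps_X ^ 3 :: 'a fps)"
    using eul_step [of 1 1 "fps_X ^ 3 :: 'a fps"] by (simp add: fps_const_power mult_ac flip: power_Suc)
  have 2: "eul 4 2 (fps_X ^ 5) = (1 - qz * fps_X ^ 2) * eul 4 2 (fps_X :: 'a fps)"
    using eul_step [of 4 2 "fps_X :: 'a fps"] by (simp flip: power_Suc)
  have 3: "coeul 6 3 (fps_X ^ 9) = (1 - qz ^ 9 * fps_X ^ 3) * coeul 6 3 (fps_X ^ 15 :: 'a fps)"
    using coeul_step [of 6 3 "fps_X ^ 9 :: 'a fps"] by (simp add: fps_const_power flip: power_add)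
  have 4: "dilate (fps_X ^ 2) seriesK
    = eul 1 1 (fps_X ^ 4) * eul 4 2 (fps_X ^ 5) * coeul 6 3 (fps_X ^ 15 :: 'a fps)"
    by (simp add: seriesK_def dilate_mult dilate_eul dilate_coeul flip: power_mult power_add power_Suc)
  have "(1 - qz ^ 3 * fps_X) * ((1 - qz * fps_X ^ 2) * seriesW)
    = (1 - qz ^ 3 * fps_X) * ((1 + qz ^ 3 * fps_X + qz ^ 6 * fps_X ^ 2)
        * dilate (fps_X ^ 2) (seriesK :: 'a fps fps))"
    unfolding 4 seriesW_def 1 2 3 by algebra
  then show ?thesis
    using one_minus_fps_X_neq_0 [of "fps_X ^ 3 :: 'a fps"]
    by (simp only: mult_cancel_left fps_const_power [symmetric] simp_thms)
qed

text \<open>The source of the telescoping: comparing coefficients of Z^n yields the relation between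
  r_n, E_n, M_(n-1) and M_n. It holds because \<open>seriesE\<close> - Z \<open>seriesW\<close> = (1
  + q Z + q^2 Z^2) \<open>seriesK\<close>, whose dilation is known.\<close>

lemma dilate_seriesE:
  "(1 - qz * fps_X ^ 2) * seriesW = dilate (fps_X ^ 2) (seriesE - fps_X * seriesW)"
proof -
  have q: "dilate (fps_X ^ 2) qz = (qz :: 'a fps fps)"
    by (simp add: fps_eq_iff)
  have X: "dilate (fps_X ^ 2) fps_X = (qz ^ 2 * fps_X :: 'a fps fps)"
    by (simp add: fps_eq_iff fps_X_def fps_const_power)
  have one: "dilate (fps_X ^ 2) 1 = (1 :: 'a fps fps)"
    by (simp add: fps_eq_iff)
  have "seriesE - fps_X * seriesW = (1 + qz * fps_X + qz * qz * fps_X * fps_X) * (seriesK :: 'a fps fps)"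
    unfolding seriesE_def seriesW_seriesK by algebra
  then have "dilate (fps_X ^ 2) (seriesE - fps_X * seriesW)
    = (1 + qz * (qz ^ 2 * fps_X) + qz * qz * (qz ^ 2 * fps_X) * (qz ^ 2 * fps_X))
      * dilate (fps_X ^ 2) (seriesK :: 'a fps fps)"
    by (simp only: dilate_mult dilate_add q X one)
  also have "\<dots> = (1 + qz ^ 3 * fps_X + qz ^ 6 * fps_X ^ 2) * dilate (fps_X ^ 2) (seriesK :: 'a fps fps)"
    by algebra
  finally show ?thesis by (simp add: dilate_seriesK)
qed

text \<open>This equation and the next are the partition recurrences for N_n and E_n after division
  by q^(n^2).\<close>

lemma seriesN_eq: "(seriesN :: 'a::field fps fps) = fps_X * seriesN + fps_X * (qz * seriesE) + dilate (fps_X ^ 2) seriesN"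
  using seriesN_seriesK [where 'a = 'a] unfolding dilate_seriesN seriesE_def by algebra

lemma seriesE_eq:
  "seriesE = dilate (fps_X ^ 2) seriesN + fps_X * ((1 + qz) * dilate (fps_X ^ 2) seriesN)
    + fps_X ^ 2 * (qz * seriesE)"
  unfolding dilate_seriesN seriesE_def by algebra


section \<open>The recursive structure of the partitions\<close>

text \<open>Conditions (i)-(iii) as a recursion that inspects three leading parts at a time. The
  part 0 is allowed, so that (iv) can be expressed by a fictitious leading 0.\<close>

fun adm :: "nat list \<Rightarrow> bool" where
  "adm [] = True"
| "adm [a] = True"
| "adm [a, b] = (a < b \<and> \<not> (even b \<and> b = a + 1))"
| "adm (a # b # c # xs) = (a < b \<and> \<not> (even b \<and> b = a + 1)
     \<and> \<not> (even a \<and> (b = a + 1 \<and> c = a + 3 \<or> b = a + 2 \<and> c = a + 3 \<or> b = a + 2 \<and> c = a + 4))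
     \<and> adm (b # c # xs))"

definition shift :: "nat list \<Rightarrow> nat list" where
  "shift = map (\<lambda>a. a + 2)"

lemma shift_simps [simp]: "shift [] = []" "shift (a # \<pi>) = (a + 2) # shift \<pi>"
  by (simp_all add: shift_def)

lemma length_shift [simp]: "length (shift \<pi>) = length \<pi>"
  by (simp add: shift_def)

lemma set_shift [simp]: "set (shift \<pi>) = (\<lambda>a. a + 2) ` set \<pi>"
  by (simp add: shift_def)

lemma sum_list_shift [simp]: "sum_list (shift \<pi>) = sum_list \<pi> + 2 * length \<pi>"
  by (induction \<pi>) auto

lemma inj_shift: "inj shift"
  by (simp add: shift_def inj_mapI inj_def)

lemma shift_map_diff: "\<forall>a\<in>set \<pi>. 2 \<le> a \<Longrightarrow> shift (map (\<lambda>a. a - 2) \<pi>) = \<pi>"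
  by (induction \<pi>) auto

text \<open>The conditions depend only on differences and parities of parts, and adding 2 changes
  neither.\<close>

lemma adm_shift [simp]: "adm (shift \<pi>) = adm \<pi>"
  by (induction \<pi> rule: adm.induct) auto

lemma adm_sorted: "adm \<pi> \<Longrightarrow> sorted_wrt (<) \<pi>"
  by (induction \<pi> rule: adm.induct) auto

text \<open>Forbidden triples start with an even part, so an odd leading part only restricts its
  neighbour; difference 1 is excluded because b would be even.\<close>

lemma adm_Cons_odd: "odd a \<Longrightarrow> adm (a # b # \<pi>) \<longleftrightarrow> a + 1 < b \<and> adm (b # \<pi>)"
  by (cases \<pi>; cases "b = a + 1") auto

lemma all_nat_split: "(\<forall>n. P n) \<longleftrightarrow> P 0 \<and> (\<forall>n. P (Suc n))"
  by (metis not0_implies_Suc)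

text \<open>Connects the recursion with the formulation in \<open>P_set\<close>: each occurrence of
  a pattern is either at the head or inside the tail.\<close>

lemma adm_iff:
  "adm \<pi> \<longleftrightarrow> sorted_wrt (<) \<pi>
     \<and> (\<forall>i. Suc i < length \<pi> \<and> even (\<pi> ! Suc i) \<longrightarrow> \<pi> ! Suc i \<noteq> \<pi> ! i + 1)
     \<and> (\<forall>j. \<not> sublist [2 * j, 2 * j + 1, 2 * j + 3] \<pi>
          \<and> \<not> sublist [2 * j, 2 * j + 2, 2 * j + 3] \<pi>
          \<and> \<not> sublist [2 * j, 2 * j + 2, 2 * j + 4] \<pi>)"
proof (induction \<pi> rule: adm.induct)
  case (3 a b)
  show ?case by (subst all_nat_split) (auto simp: sublist_Cons_right)
next
  case (4 a b c xs)
  have sorted: "sorted_wrt (<) (a # b # c # xs) \<longleftrightarrow> a < b \<and> sorted_wrt (<) (b # c # xs)"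
    by auto
  have adjacent: "(\<forall>i. Suc i < length (a # b # c # xs) \<and> even ((a # b # c # xs) ! Suc i)
        \<longrightarrow> (a # b # c # xs) ! Suc i \<noteq> (a # b # c # xs) ! i + 1)
     \<longleftrightarrow> \<not> (even b \<and> b = a + 1) \<and> (\<forall>i. Suc i < length (b # c # xs) \<and> even ((b # c # xs) ! Suc i)
        \<longrightarrow> (b # c # xs) ! Suc i \<noteq> (b # c # xs) ! i + 1)"
    by (subst all_nat_split) auto
  have sublist: "sublist [u, v, w] (a # b # c # xs) \<longleftrightarrow>
      u = a \<and> v = b \<and> w = c \<or> sublist [u, v, w] (b # c # xs)" for u v w
    by (auto simp: sublist_Cons_right [of _ a])
  have triples: "(\<forall>j. \<not> sublist [2 * j, 2 * j + 1, 2 * j + 3] (a # b # c # xs)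
          \<and> \<not> sublist [2 * j, 2 * j + 2, 2 * j + 3] (a # b # c # xs)
          \<and> \<not> sublist [2 * j, 2 * j + 2, 2 * j + 4] (a # b # c # xs))
    \<longleftrightarrow> \<not> (even a \<and> (b = a + 1 \<and> c = a + 3 \<or> b = a + 2 \<and> c = a + 3 \<or> b = a + 2 \<and> c = a + 4))
     \<and> (\<forall>j. \<not> sublist [2 * j, 2 * j + 1, 2 * j + 3] (b # c # xs)
          \<and> \<not> sublist [2 * j, 2 * j + 2, 2 * j + 3] (b # c # xs)
          \<and> \<not> sublist [2 * j, 2 * j + 2, 2 * j + 4] (b # c # xs))"
    \<comment> \<open>At the head only j = a / 2 can match, so the quantifier over j turns into
      evenness of a.\<close>
    unfolding sublist by (auto elim!: evenE)
  show ?case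
    unfolding adm.simps sorted adjacent triples 4 by blast
qed (auto simp: sublist_Cons_right)

text \<open>For j = 0 the forbidden triples are 0 followed by 1+3, 2+3 or 2+4, which gives the three
  prefixes.\<close>

lemma adm_0_Cons_iff:
  "adm (0 # \<pi>) \<longleftrightarrow> adm \<pi> \<and> 0 \<notin> set \<pi> \<and> \<not> prefix [1, 3] \<pi> \<and> \<not> prefix [2, 3] \<pi> \<and> \<not> prefix [2, 4] \<pi>"
proof (cases "0 # \<pi>" rule: adm.cases)
  case (4 a b c xs)
  show ?thesis
    using 4 adm_sorted [of "b # c # xs"] by auto
qed auto

text \<open>Condition (iv) forbids the pairs anywhere, the leading 0 only at the front. These agree:
  no positive part precedes 1, and only 1 could precede 2, which (ii) rules out.\<close>

lemma P_set_eq: "P_set = {\<pi>. adm (0 # \<pi>)}"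
proof -
  have "\<pi> \<in> P_set \<longleftrightarrow> adm \<pi> \<and> 0 \<notin> set \<pi> \<and> \<not> sublist [1, 3] \<pi> \<and> \<not> sublist [2, 3] \<pi> \<and> \<not> sublist [2, 4] \<pi>" for \<pi>
    unfolding P_set_def is_partition_def adm_iff strict_sorted_iff by auto
  moreover have "prefix [a, b] \<pi>"
    if sub: "sublist [a, b] \<pi>" and adm: "adm \<pi>" and pos: "0 \<notin> set \<pi>" and a: "a = 1 \<or> a = 2" for a b \<pi>
  proof -
    obtain ps ss where \<pi>: "\<pi> = ps @ [a, b] @ ss"
      using sub unfolding sublist_def by blast
    have "ps = []"
    proof (rule ccontr)
      assume "ps \<noteq> []"
      then obtain us y where ps: "ps = us @ [y]"
        by (metis rev_exhaust)
      have "y < a" "y \<noteq> 0"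
        using adm_sorted [OF adm] pos by (auto simp: \<pi> ps sorted_wrt_append)
      then have "y = 1" "a = 2" using a by auto
      moreover have "\<pi> ! Suc (length us) = a" "\<pi> ! length us = y" "Suc (length us) < length \<pi>"
        by (simp_all add: \<pi> ps nth_append)
      ultimately show False
        using adm unfolding adm_iff by (metis even_numeral one_add_one)
    qed
    then show ?thesis by (simp add: \<pi>)
  qed
  ultimately have "\<pi> \<in> P_set \<longleftrightarrow> adm (0 # \<pi>)" for \<pi>
    unfolding adm_0_Cons_iff by (metis prefix_imp_sublist)
  then show ?thesis by blast
qed

section \<open>Decomposition by the smallest part\<close>

definition setN :: "nat list set" where "setN = {\<pi>. adm \<pi> \<and> 0 \<notin> set \<pi>}"

definition setE :: "nat list set" where "setE = {\<pi>. adm (0 # \<pi>)}"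

lemma setE_subset_setN: "setE \<subseteq> setN"
  by (auto simp: setE_def setN_def adm_0_Cons_iff)

lemma shift_image_setN: "shift ` setN = {\<pi>. adm \<pi> \<and> (\<forall>a\<in>set \<pi>. 3 \<le> a)}"
proof (intro equalityI subsetI)
  fix \<pi> assume "\<pi> \<in> {\<pi>. adm \<pi> \<and> (\<forall>a\<in>set \<pi>. 3 \<le> a)}"
  then have \<pi>: "adm \<pi>" "\<forall>a\<in>set \<pi>. 3 \<le> a" by auto
  let ?\<sigma> = "map (\<lambda>a. a - 2) \<pi>"
  have "shift ?\<sigma> = \<pi>" using \<pi>(2) by (intro shift_map_diff) auto
  moreover from this have "adm ?\<sigma>" using \<pi>(1) adm_shift by metis
  ultimately show "\<pi> \<in> shift ` setN"
    using \<pi>(2) by (intro image_eqI [of _ _ ?\<sigma>]) (auto simp: setN_def)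
qed (auto simp: setN_def Suc_le_eq intro!: gr0I)

text \<open>Subtracting 2 turns the leading 2 into the fictitious 0 that defines
  \<open>setE\<close>.\<close>

lemma Cons_2_shift_setE: "2 # \<pi> \<in> setN \<longleftrightarrow> \<pi> \<in> shift ` setE"
proof
  assume "2 # \<pi> \<in> setN"
  then have adm: "adm (2 # \<pi>)" by (simp add: setN_def)
  then have gt: "\<forall>a\<in>set \<pi>. 2 < a" using adm_sorted by fastforce
  let ?\<sigma> = "map (\<lambda>a. a - 2) \<pi>"
  have "shift ?\<sigma> = \<pi>" using gt by (intro shift_map_diff) auto
  moreover from this have "adm (0 # ?\<sigma>)" using adm adm_shift [of "0 # ?\<sigma>"] by (simp add: numeral_2_eq_2)
  ultimately show "\<pi> \<in> shift ` setE"
    by (intro image_eqI [of _ _ ?\<sigma>]) (auto simp: setE_def)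
next
  assume "\<pi> \<in> shift ` setE"
  then obtain \<sigma> where "\<pi> = shift \<sigma>" "adm (0 # \<sigma>)" by (auto simp: setE_def)
  then show "2 # \<pi> \<in> setN" using adm_shift [of "0 # \<sigma>"] by (auto simp: setN_def numeral_2_eq_2)
qed

text \<open>As 1 is odd, it requires only that the next part be at least 3.\<close>

lemma Cons_1_shift_setN: "1 # \<pi> \<in> setN \<longleftrightarrow> \<pi> \<in> shift ` setN"
  unfolding shift_image_setN
proof (cases \<pi>)
  case (Cons b \<rho>)
  then show "1 # \<pi> \<in> setN \<longleftrightarrow> \<pi> \<in> {\<pi>. adm \<pi> \<and> (\<forall>a\<in>set \<pi>. 3 \<le> a)}"
    using adm_sorted [of \<pi>] by (fastforce simp: setN_def adm_Cons_odd)
qed (simp add: setN_def)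

lemma Cons_ge_3_setN: "3 \<le> a \<Longrightarrow> a # \<pi> \<in> setN \<longleftrightarrow> a # \<pi> \<in> shift ` setN"
  unfolding shift_image_setN using adm_sorted [of "a # \<pi>"] by (fastforce simp: setN_def)

text \<open>The cases are: all parts at least 3 (including the empty partition), smallest part 1,
  smallest part 2.\<close>

lemma in_setN_iff:
  "\<pi> \<in> setN \<longleftrightarrow> \<pi> \<in> shift ` setN \<or> \<pi> \<in> (#) 1 ` shift ` setN \<or> \<pi> \<in> (#) 2 ` shift ` setE"
proof (cases \<pi>)
  case (Cons a \<rho>)
  consider "a = 0" | "a = 1" | "a = 2" | "3 \<le> a" by linarith
  then show ?thesis
  proof cases
    case 1
    then have "\<pi> \<notin> setN" "\<pi> \<notin> shift ` setN"
      by (simp_all add: Cons shift_image_setN) (simp add: setN_def)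
    then show ?thesis using 1 by (auto simp: Cons)
  next
    case 2
    then have "\<pi> \<notin> shift ` setN" by (auto simp: Cons shift_image_setN)
    then show ?thesis using 2 Cons_1_shift_setN [of \<rho>] by (auto simp: Cons)
  next
    case 3
    then have "\<pi> \<notin> shift ` setN" by (auto simp: Cons shift_image_setN)
    then show ?thesis using 3 Cons_2_shift_setE [of \<rho>] by (auto simp: Cons)
  next
    case 4
    then show ?thesis using Cons_ge_3_setN [of a \<rho>] by (auto simp: Cons)
  qed
next
  case Nil
  then have "\<pi> \<in> setN" "\<pi> \<in> shift ` setN"
    by (simp_all add: shift_image_setN) (simp add: setN_def)
  then show ?thesis by simp
qed

lemma setN_eq: "setN = shift ` setN \<union> (#) 1 ` shift ` setN \<union> (#) 2 ` shift ` setE"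
  using in_setN_iff by (intro set_eqI) (simp only: Un_iff disj_assoc)

lemma setN_not_1_eq: "{\<pi> \<in> setN. 1 \<notin> set \<pi>} = shift ` setN \<union> (#) 2 ` shift ` setE"
proof -
  have "1 \<notin> set \<pi>" if "\<pi> \<in> shift ` setN \<union> (#) 2 ` shift ` setE" for \<pi>
    using that by auto
  moreover have "1 \<in> set \<pi>" if "\<pi> \<in> (#) 1 ` shift ` setN" for \<pi>
    using that by auto
  ultimately have "\<pi> \<in> setN \<and> 1 \<notin> set \<pi> \<longleftrightarrow> \<pi> \<in> shift ` setN \<union> (#) 2 ` shift ` setE" for \<pi>
    using in_setN_iff [of \<pi>] by blast
  then show ?thesis by blast
qed

text \<open>Condition (iv) prunes the decomposition of \<open>setN\<close>. After 1 the part 3 is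
  forbidden, hence 1 in the shifted-back rest; after 2 the parts 3 and 4 are forbidden, hence 1 and
  2 in the rest, which is then itself a shift.\<close>

lemma setE_eq:
  "setE = shift ` setN \<union> (#) 1 ` shift ` {\<pi> \<in> setN. 1 \<notin> set \<pi>} \<union> (#) 2 ` shift ` shift ` setN"
proof -
  have E: "\<pi> \<in> setE \<longleftrightarrow> \<pi> \<in> setN \<and> \<not> prefix [1, 3] \<pi> \<and> \<not> prefix [2, 3] \<pi> \<and> \<not> prefix [2, 4] \<pi>" for \<pi>
    by (simp add: setE_def setN_def adm_0_Cons_iff)
  have ge3: "\<pi> \<in> setE" if "\<pi> \<in> shift ` setN" for \<pi>
  proof -
    have "\<pi> \<in> setN" using that in_setN_iff [of \<pi>] by simp
    then show ?thesis using that unfolding E shift_image_setN by (cases \<pi>) auto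
  qed
  have f1: "1 # shift \<sigma> \<in> setE \<longleftrightarrow> \<sigma> \<in> {\<pi> \<in> setN. 1 \<notin> set \<pi>}" if "\<sigma> \<in> setN" for \<sigma>
  proof -
    have "1 # shift \<sigma> \<in> setN" using that Cons_1_shift_setN by blast
    then have "1 # shift \<sigma> \<in> setE \<longleftrightarrow> \<not> prefix [1] \<sigma>"
      by (cases \<sigma>) (auto simp: E)
    also have "\<dots> \<longleftrightarrow> 1 \<notin> set \<sigma>"
      using that adm_sorted [of \<sigma>] by (cases \<sigma>) (auto simp: setN_def)
    finally show ?thesis using that by simp
  qed
  have f2: "2 # shift \<sigma> \<in> setE \<longleftrightarrow> \<sigma> \<in> shift ` setN" if "\<sigma> \<in> setE" for \<sigma>
  proof -
    have "2 # shift \<sigma> \<in> setN" using that Cons_2_shift_setE by blast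
    then have "2 # shift \<sigma> \<in> setE \<longleftrightarrow> \<not> prefix [1] \<sigma> \<and> \<not> prefix [2] \<sigma>"
      by (cases \<sigma>) (auto simp: E)
    also have "\<dots> \<longleftrightarrow> \<sigma> \<in> shift ` setN"
    proof
      assume *: "\<not> prefix [1] \<sigma> \<and> \<not> prefix [2] \<sigma>"
      have "\<sigma> \<in> setN" using that setE_subset_setN by blast
      then show "\<sigma> \<in> shift ` setN" using * in_setN_iff [of \<sigma>] by auto
    next
      assume "\<sigma> \<in> shift ` setN"
      then show "\<not> prefix [1] \<sigma> \<and> \<not> prefix [2] \<sigma>" by (cases \<sigma>) (auto simp: shift_image_setN)
    qed
    finally show ?thesis .
  qed
  show ?thesis
  proof (intro equalityI subsetI)
    fix \<pi> assume \<pi>: "\<pi> \<in> setE"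
    then consider "\<pi> \<in> shift ` setN" | \<sigma> where "\<pi> = 1 # shift \<sigma>" "\<sigma> \<in> setN"
      | \<sigma> where "\<pi> = 2 # shift \<sigma>" "\<sigma> \<in> setE"
      using setE_subset_setN in_setN_iff [of \<pi>] by blast
    then show "\<pi> \<in> shift ` setN \<union> (#) 1 ` shift ` {\<pi> \<in> setN. 1 \<notin> set \<pi>} \<union> (#) 2 ` shift ` shift ` setN"
    proof cases
      case 1 then show ?thesis by blast
    next
      case 2
      then have "\<sigma> \<in> {\<pi> \<in> setN. 1 \<notin> set \<pi>}" using f1 [of \<sigma>] \<pi> by simp
      then show ?thesis using 2(1) by blast
    next
      case 3
      then have "\<sigma> \<in> shift ` setN" using f2 [of \<sigma>] \<pi> by simp
      then show ?thesis using 3(1) by blast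
    qed
  next
    fix \<pi>
    assume "\<pi> \<in> shift ` setN \<union> (#) 1 ` shift ` {\<pi> \<in> setN. 1 \<notin> set \<pi>} \<union> (#) 2 ` shift ` shift ` setN"
    then consider "\<pi> \<in> shift ` setN" | \<sigma> where "\<pi> = 1 # shift \<sigma>" "\<sigma> \<in> {\<pi> \<in> setN. 1 \<notin> set \<pi>}"
      | \<sigma> where "\<pi> = 2 # shift \<sigma>" "\<sigma> \<in> shift ` setN"
      by blast
    then show "\<pi> \<in> setE"
    proof cases
      case 1 then show ?thesis by (rule ge3)
    next
      case 2 then show ?thesis using f1 [of \<sigma>] by simp
    next
      case 3 then show ?thesis using f2 [of \<sigma>] ge3 [of \<sigma>] by simp
    qed
  qed
qed

section \<open>Generating functions by number of parts\<close>

definition len_gf :: "nat list set \<Rightarrow> nat \<Rightarrow> 'a::comm_ring_1 fps" where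
  "len_gf A n = Abs_fps (\<lambda>s. of_nat (card {\<pi> \<in> A. length \<pi> = n \<and> sum_list \<pi> = s}))"

lemma finite_length_sum_list: "finite {\<pi> :: nat list. P \<pi> \<and> length \<pi> = n \<and> sum_list \<pi> = s}"
proof (rule finite_subset)
  show "{\<pi>. P \<pi> \<and> length \<pi> = n \<and> sum_list \<pi> = s} \<subseteq> {\<pi>. set \<pi> \<subseteq> {..s} \<and> length \<pi> = n}"
    using member_le_sum_list by fastforce
qed (simp add: finite_lists_length_eq)

lemma len_gf_Un: "A \<inter> B = {} \<Longrightarrow> len_gf (A \<union> B) n = len_gf A n + len_gf B n"
proof (rule fps_ext)
  fix s
  assume "A \<inter> B = {}"
  moreover have "{\<pi> \<in> A \<union> B. length \<pi> = n \<and> sum_list \<pi> = s}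
      = {\<pi> \<in> A. length \<pi> = n \<and> sum_list \<pi> = s} \<union> {\<pi> \<in> B. length \<pi> = n \<and> sum_list \<pi> = s}"
    by auto
  ultimately show "fps_nth (len_gf (A \<union> B) n) s = fps_nth (len_gf A n + len_gf B n) s"
    by (auto simp: len_gf_def finite_length_sum_list card_Un_disjoint disjoint_iff)
qed

text \<open>A common transport rule for shifting and for prepending a part: an injection that raises
  every sum by k multiplies the generating function by q^k.\<close>

lemma len_gf_image:
  assumes "inj f" "\<And>\<pi>. length (f \<pi>) = n \<longleftrightarrow> length \<pi> = m"
    and "\<And>\<pi>. length \<pi> = m \<Longrightarrow> sum_list (f \<pi>) = sum_list \<pi> + k"
  shows "len_gf (f ` A) n = fps_X ^ k * len_gf A m"
proof (rule fps_ext)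
  fix s
  have "{\<pi> \<in> f ` A. length \<pi> = n \<and> sum_list \<pi> = s}
      = f ` {\<pi> \<in> A. length \<pi> = m \<and> sum_list \<pi> + k = s}"
  proof (intro equalityI subsetI)
    fix \<rho> assume "\<rho> \<in> {\<pi> \<in> f ` A. length \<pi> = n \<and> sum_list \<pi> = s}"
    then obtain \<pi> where "\<rho> = f \<pi>" "\<pi> \<in> A" "length \<pi> = m" "sum_list (f \<pi>) = s"
      using assms(2) by auto
    then show "\<rho> \<in> f ` {\<pi> \<in> A. length \<pi> = m \<and> sum_list \<pi> + k = s}"
      using assms(3) [of \<pi>] by simp
  qed (use assms(2,3) in auto)
  then have "card {\<pi> \<in> f ` A. length \<pi> = n \<and> sum_list \<pi> = s}
      = card {\<pi> \<in> A. length \<pi> = m \<and> sum_list \<pi> + k = s}"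
    using assms(1) by (simp add: card_image inj_on_subset)
  moreover have "{\<pi> \<in> A. length \<pi> = m \<and> sum_list \<pi> + k = s}
      = (if s < k then {} else {\<pi> \<in> A. length \<pi> = m \<and> sum_list \<pi> = s - k})"
    by auto
  ultimately show "fps_nth (len_gf (f ` A) n) s = fps_nth (fps_X ^ k * len_gf A m) s"
    by (simp add: len_gf_def fps_X_power_mult_nth)
qed

lemma len_gf_shift: "len_gf (shift ` A) n = fps_X ^ (2 * n) * len_gf A n"
  by (rule len_gf_image) (auto simp: inj_shift)

lemma len_gf_Cons_Suc: "len_gf ((#) a ` A) (Suc n) = fps_X ^ a * len_gf A n"
  by (rule len_gf_image) auto

lemma len_gf_Cons_0: "len_gf ((#) a ` A) 0 = 0"
proof -
  have "{\<pi> \<in> (#) a ` A. length \<pi> = 0 \<and> sum_list \<pi> = s} = {}" for s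
    by auto
  then show ?thesis by (simp only: len_gf_def fps_eq_iff) simp
qed

lemma len_gf_0: "[] \<in> A \<Longrightarrow> len_gf A 0 = 1"
proof -
  assume "[] \<in> A"
  then have "{\<pi> \<in> A. length \<pi> = 0 \<and> sum_list \<pi> = s} = (if s = 0 then {[]} else {})" for s
    by auto
  then show ?thesis by (simp only: len_gf_def fps_eq_iff) simp
qed

text \<open>Each of the n parts behind a leading 1 or 2 is raised by 2, whence the exponents 2 n + 1
  and 2 n + 2.\<close>

lemma len_gf_setN_Suc:
  "len_gf setN (Suc n) = fps_X ^ (2 * Suc n) * len_gf setN (Suc n)
    + fps_X ^ (2 * n + 1) * len_gf setN n + fps_X ^ (2 * n + 2) * len_gf setE n"
proof -
  have "(shift ` setN \<union> (#) 1 ` shift ` setN) \<inter> (#) 2 ` shift ` setE = {}"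
    "shift ` setN \<inter> (#) 1 ` shift ` setN = {}"
    by (auto simp: shift_image_setN)
  then have "len_gf setN (Suc n) = len_gf (shift ` setN) (Suc n)
      + len_gf ((#) 1 ` shift ` setN) (Suc n) + len_gf ((#) 2 ` shift ` setE) (Suc n)"
    by (subst setN_eq) (simp only: len_gf_Un)
  then show ?thesis
    by (simp add: len_gf_shift len_gf_Cons_Suc power_add mult_ac power2_eq_square)
qed

lemma len_gf_setN_not_1:
  "len_gf {\<pi> \<in> setN. 1 \<notin> set \<pi>} n
    = fps_X ^ (2 * n) * len_gf setN n + (case n of 0 \<Rightarrow> 0 | Suc m \<Rightarrow> fps_X ^ (2 * m + 2) * len_gf setE m)"
proof -
  have "shift ` setN \<inter> (#) 2 ` shift ` setE = {}"
    by (auto simp: shift_image_setN)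
  then have "len_gf {\<pi> \<in> setN. 1 \<notin> set \<pi>} n = len_gf (shift ` setN) n + len_gf ((#) 2 ` shift ` setE) n"
    by (subst setN_not_1_eq) (simp only: len_gf_Un)
  then show ?thesis
    by (cases n) (simp_all add: len_gf_shift len_gf_Cons_Suc len_gf_Cons_0 power_add mult_ac power2_eq_square)
qed

text \<open>The leading parts 1 and 2 can both be followed by a doubly shifted member of
  \<open>setN\<close>, giving q^(4n+1) + q^(4n+2). The last term counts partitions beginning with
  1+4; it needs two parts and is 0 for n = 0.\<close>

lemma len_gf_setE_Suc:
  "len_gf setE (Suc n) = fps_X ^ (2 * Suc n) * len_gf setN (Suc n)
    + (1 + fps_X) * fps_X ^ (4 * n + 1) * len_gf setN n
    + (case n of 0 \<Rightarrow> 0 | Suc m \<Rightarrow> fps_X ^ (4 * m + 5) * len_gf setE m)"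
proof -
  have "(shift ` setN \<union> (#) 1 ` shift ` {\<pi> \<in> setN. 1 \<notin> set \<pi>}) \<inter> (#) 2 ` shift ` shift ` setN = {}"
    "shift ` setN \<inter> (#) 1 ` shift ` {\<pi> \<in> setN. 1 \<notin> set \<pi>} = {}"
    by (auto simp: shift_image_setN)
  then have "len_gf setE (Suc n) = len_gf (shift ` setN) (Suc n)
      + len_gf ((#) 1 ` shift ` {\<pi> \<in> setN. 1 \<notin> set \<pi>}) (Suc n)
      + len_gf ((#) 2 ` shift ` shift ` setN) (Suc n)"
    by (subst setE_eq) (simp only: len_gf_Un)
  then have eq: "len_gf setE (Suc n) = fps_X ^ (2 * Suc n) * len_gf setN (Suc n)
      + fps_X * (fps_X ^ (2 * n) * len_gf {\<pi> \<in> setN. 1 \<notin> set \<pi>} n)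
      + fps_X ^ 2 * (fps_X ^ (2 * n) * (fps_X ^ (2 * n) * len_gf setN n) :: 'a fps)"
    by (simp only: len_gf_shift len_gf_Cons_Suc power_one_right)
  have e1: "fps_X ^ (4 * n + 1) = fps_X * (fps_X ^ (2 * n) * fps_X ^ (2 * n) :: 'a fps)"
    by (simp flip: power_add)
  show ?thesis
  proof (cases n)
    case 0
    then show ?thesis unfolding eq len_gf_setN_not_1 by (simp add: algebra_simps power2_eq_square)
  next
    case (Suc m)
    have e2: "fps_X ^ (4 * m + 5) = fps_X * (fps_X ^ (2 * n) * fps_X ^ (2 * m + 2) :: 'a fps)"
      by (simp add: Suc flip: power_add power_Suc)
    have case_n: "(case n of 0 \<Rightarrow> 0 | Suc m \<Rightarrow> g m) = g m" for g :: "nat \<Rightarrow> 'a fps"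
      by (simp add: Suc)
    show ?thesis unfolding eq len_gf_setN_not_1 e1 case_n e2
      by (simp add: algebra_simps power2_eq_square)
  qed
qed

section \<open>Coefficient recurrences and their solution\<close>

lemma eul_nth_0: "fps_nth (eul p d a) 0 = 1"
  by (simp add: eul_def qpoch_def)

lemma coeul_nth_0: "fps_nth (coeul p d c) 0 = 1"
  by (simp add: coeul_def qpoch_def numeral_2_eq_2)

lemma series_nth_0 [simp]:
  "fps_nth seriesN 0 = 1" "fps_nth seriesE 0 = 1" "fps_nth seriesW 0 = 1"
  by (simp_all add: seriesN_def seriesE_def seriesK_def seriesW_def eul_nth_0 coeul_nth_0)

lemma seriesN_nth_Suc:
  "fps_nth seriesN (Suc n) = fps_nth seriesN n + fps_X * fps_nth seriesE n
    + fps_X ^ (2 * Suc n) * fps_nth (seriesN :: 'a::field fps fps) (Suc n)"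
  using arg_cong [where f = "\<lambda>s. fps_nth s (Suc n)", OF seriesN_eq [where 'a = 'a]]
  by (simp add: power2_eq_square power4_eq_xxxx mult.assoc power_mult)

lemma seriesE_nth_Suc:
  "fps_nth seriesE (Suc n) = fps_X ^ (2 * Suc n) * fps_nth seriesN (Suc n)
    + (1 + fps_X) * fps_X ^ (2 * n) * fps_nth seriesN n
    + (case n of 0 \<Rightarrow> 0 | Suc m \<Rightarrow> fps_X * fps_nth (seriesE :: 'a::field fps fps) m)"
  using arg_cong [where f = "\<lambda>s. fps_nth s (Suc n)", OF seriesE_eq [where 'a = 'a]]
  by (cases n) (simp_all add: distrib_right fps_X_power_mult_nth power2_eq_square power4_eq_xxxx mult.assoc power_mult)

lemma seriesW_nth_Suc:
  "fps_nth seriesW (Suc n) + fps_X ^ (2 * Suc n) * fps_nth seriesW n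
    = fps_X ^ (2 * Suc n) * fps_nth seriesE (Suc n)
      + (case n of 0 \<Rightarrow> 0 | Suc m \<Rightarrow> fps_X * fps_nth (seriesW :: 'a::field fps fps) m)"
  using arg_cong [where f = "\<lambda>s. fps_nth s (Suc n)", OF dilate_seriesE [where 'a = 'a]]
  by (cases n) (simp_all add: left_diff_distrib right_diff_distrib diff_eq_eq diff_add_eq eq_diff_eq mult.assoc fps_X_power_mult_nth
      power2_eq_square power4_eq_xxxx mult.assoc power_mult)

text \<open>Both sides satisfy the same recurrences. The induction is strong because E_n refers back
  to E_(n-2), and N_n is settled before E_n, whose recurrence contains it.\<close>

lemma len_gf_eq_series:
  "len_gf setN n = fps_X ^ (n ^ 2) * fps_nth (seriesN :: 'a::field fps fps) n"
  "len_gf setE n = fps_X ^ (n ^ 2) * fps_nth (seriesE :: 'a::field fps fps) n"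
proof (induction n rule: less_induct)
  case (less n)
  let ?N = "fps_nth (seriesN :: 'a fps fps)" and ?E = "fps_nth (seriesE :: 'a fps fps)"
  have IH: "len_gf setN m = fps_X ^ (m ^ 2) * ?N m" "len_gf setE m = fps_X ^ (m ^ 2) * ?E m"
    if "m < n" for m
    using less [OF that] by auto
  have "len_gf setN n = fps_X ^ (n ^ 2) * ?N n \<and> len_gf setE n = fps_X ^ (n ^ 2) * ?E n"
  proof (cases n)
    case 0
    have "[] \<in> setN" "[] \<in> setE" by (simp_all add: setN_def setE_def)
    then show ?thesis by (simp add: 0 len_gf_0)
  next
    case (Suc m)
    have pow: "fps_X ^ (n ^ 2) = fps_X ^ (m ^ 2) * (fps_X ^ (2 * m + 1) :: 'a fps)"
      by (simp add: Suc power2_eq_square flip: power_add power_Suc)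
    \<comment> \<open>The recurrence contains N_n on its right side too; collecting it leaves the
      factor 1 - q^(2n), which is nonzero since n > 0 and is cancelled below.\<close>
    have "(1 - fps_X ^ (2 * n)) * len_gf setN n
        = fps_X ^ (2 * m + 1) * (fps_X ^ (m ^ 2) * ?N m) + fps_X ^ (2 * m + 2) * (fps_X ^ (m ^ 2) * ?E m)"
      using len_gf_setN_Suc [of m, where 'a = 'a] IH [of m] by (simp only: Suc lessI) (simp add: algebra_simps)
    also have "\<dots> = fps_X ^ (n ^ 2) * (?N m + fps_X * ?E m)"
      unfolding pow by (simp add: algebra_simps)
    also have "?N m + fps_X * ?E m = (1 - fps_X ^ (2 * n)) * ?N n"
      using seriesN_nth_Suc [of m, where 'a = 'a] by (simp only: Suc) (simp add: algebra_simps)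
    also have "fps_X ^ (n ^ 2) * \<dots> = (1 - fps_X ^ (2 * n)) * (fps_X ^ (n ^ 2) * ?N n)"
      by (rule mult.left_commute)
    finally have eq: "(1 - fps_X ^ (2 * n)) * len_gf setN n = (1 - fps_X ^ (2 * n)) * (fps_X ^ (n ^ 2) * ?N n)" .
    have "fps_nth (1 - fps_X ^ (2 * n)) 0 \<noteq> (0 :: 'a)" using Suc by simp
    then have "1 - fps_X ^ (2 * n) \<noteq> (0 :: 'a fps)" by (metis fps_zero_nth)
    then have N: "len_gf setN n = fps_X ^ (n ^ 2) * ?N n"
      using eq by (simp only: mult_cancel_left simp_thms)
    have 1: "fps_X ^ (4 * m + 1) * (fps_X ^ (m ^ 2) * ?N m) = fps_X ^ (n ^ 2) * (fps_X ^ (2 * m) * ?N m)"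
      unfolding pow by (simp add: mult_ac flip: power_add power_Suc)
    have 2: "(case m of 0 \<Rightarrow> 0 | Suc l \<Rightarrow> fps_X ^ (4 * l + 5) * len_gf setE l)
        = fps_X ^ (n ^ 2) * (case m of 0 \<Rightarrow> 0 | Suc l \<Rightarrow> fps_X * ?E l)"
    proof (cases m)
      case (Suc l)
      \<comment> \<open>Here n = l + 2, so n^2 - l^2 = 4 l + 4 and a single q remains.\<close>
      have "l ^ 2 + (4 * l + 5) = n ^ 2 + 1"
        by (simp add: Suc \<open>n = Suc m\<close> power2_eq_square)
      then have "fps_X ^ (l ^ 2) * fps_X ^ (4 * l + 5) = fps_X ^ (n ^ 2) * (fps_X :: 'a fps)"
        by (metis power_add power_one_right)
      then have "fps_X ^ (l ^ 2) * fps_X ^ (4 * l + 5) * ?E l = fps_X ^ (n ^ 2) * fps_X * ?E l"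
        by (rule arg_cong)
      then show ?thesis
        using IH(2) [of l] Suc \<open>n = Suc m\<close> by (simp add: mult_ac)
    qed simp
    have "(len_gf setE n :: 'a fps) = fps_X ^ (2 * n) * len_gf setN n
        + (1 + fps_X) * (fps_X ^ (4 * m + 1) * len_gf setN m)
        + (case m of 0 \<Rightarrow> 0 | Suc l \<Rightarrow> fps_X ^ (4 * l + 5) * len_gf setE l)"
      using len_gf_setE_Suc [of m, where 'a = 'a] unfolding Suc mult.assoc .
    also have "\<dots> = fps_X ^ (2 * n) * (fps_X ^ (n ^ 2) * ?N n)
        + (1 + fps_X) * (fps_X ^ (n ^ 2) * (fps_X ^ (2 * m) * ?N m))
        + fps_X ^ (n ^ 2) * (case m of 0 \<Rightarrow> 0 | Suc l \<Rightarrow> fps_X * ?E l)"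
      unfolding 2 N 1 [symmetric] using IH(1) [of m] Suc by simp
    also have "\<dots> = fps_X ^ (n ^ 2) * ?E n"
    proof -
      have "?E n = fps_X ^ (2 * n) * ?N n + (1 + fps_X) * fps_X ^ (2 * m) * ?N m
          + (case m of 0 \<Rightarrow> 0 | Suc l \<Rightarrow> fps_X * ?E l)"
        using seriesE_nth_Suc [of m, where 'a = 'a] by (simp only: Suc)
      then show ?thesis by (simp only: distrib_left mult_ac)
    qed
    finally show ?thesis using N by blast
  qed
  then show "len_gf setN n = fps_X ^ (n ^ 2) * ?N n" "len_gf setE n = fps_X ^ (n ^ 2) * ?E n"
    by auto
qed

section \<open>The triple sum\<close>

text \<open>Specialises the Cauchy product to a factor that is a series in Z^d, as
  \<open>eul\<close> and \<open>coeul\<close> are.\<close>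

lemma fps_mult_nth_spread:
  fixes f g :: "'a::comm_ring_1 fps"
  assumes "0 < d" "\<And>m. \<not> d dvd m \<Longrightarrow> fps_nth g m = 0"
  shows "fps_nth (f * g) n = (\<Sum>j | d * j \<le> n. fps_nth f (n - d * j) * fps_nth g (d * j))"
proof -
  have "fps_nth (f * g) n = fps_nth (g * f) n"
    by (simp only: mult.commute)
  also have "\<dots> = (\<Sum>m=0..n. fps_nth f (n - m) * fps_nth g m)"
    unfolding fps_mult_nth by (intro sum.cong refl mult.commute)
  also have "\<dots> = (\<Sum>m | m \<le> n \<and> d dvd m. fps_nth f (n - m) * fps_nth g m)"
    using assms(2) by (intro sum.mono_neutral_right) auto
  also have "\<dots> = (\<Sum>j | d * j \<le> n. fps_nth f (n - d * j) * fps_nth g (d * j))"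
    using assms(1) by (intro sum.reindex_bij_witness [of _ "\<lambda>j. d * j" "\<lambda>m. m div d"]) auto
  finally show ?thesis .
qed

text \<open>The weights 1, 2, 3 are the powers of Z in the three Euler products.\<close>

definition triples :: "nat \<Rightarrow> (nat \<times> nat \<times> nat) set" where
  "triples n = {(i, j, k). i + 2 * j + 3 * k = n}"

lemma finite_triples: "finite (triples n)"
  by (rule finite_subset [of _ "{..n} \<times> {..n} \<times> {..n}"]) (auto simp: triples_def)

lemma eul_eul_coeul_nth:
  "fps_nth (eul 1 1 a * eul 4 2 b * coeul 6 3 c :: 'a::field fps fps) n
    = (\<Sum>(i, j, k)\<in>triples n. a ^ i / qpoch fps_X fps_X i * (b ^ j / qpoch (fps_X ^ 4) (fps_X ^ 4) j)
        * ((- c) ^ k * fps_X ^ (6 * (k choose 2)) / qpoch (fps_X ^ 6) (fps_X ^ 6) k))"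
proof -
  have "fps_nth (eul 1 1 a * eul 4 2 b * coeul 6 3 c) n
    = (\<Sum>k | 3 * k \<le> n. \<Sum>j | 2 * j \<le> n - 3 * k. fps_nth (eul 1 1 a) (n - 3 * k - 2 * j)
        * fps_nth (eul 4 2 b) (2 * j) * fps_nth (coeul 6 3 c) (3 * k))"
  proof -
    have "fps_nth (f * coeul 6 3 c) n = (\<Sum>k | 3 * k \<le> n. fps_nth f (n - 3 * k) * fps_nth (coeul 6 3 c) (3 * k))"
      for f by (rule fps_mult_nth_spread) (auto simp: coeul_def)
    moreover have "fps_nth (f * eul 4 2 b) m = (\<Sum>j | 2 * j \<le> m. fps_nth f (m - 2 * j) * fps_nth (eul 4 2 b) (2 * j))"
      for f m by (rule fps_mult_nth_spread) (auto simp: eul_def)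
    ultimately show ?thesis by (simp only: sum_distrib_right)
  qed
  also have "\<dots> = (\<Sum>(k, j)\<in>(SIGMA k:{k. 3 * k \<le> n}. {j. 2 * j \<le> n - 3 * k}).
      fps_nth (eul 1 1 a) (n - 3 * k - 2 * j)
        * fps_nth (eul 4 2 b) (2 * j) * fps_nth (coeul 6 3 c) (3 * k))"
  proof (rule sum.Sigma)
    show "finite {k. 3 * k \<le> n}"
      by (rule finite_subset [of _ "{..n}"]) auto
    show "\<forall>k\<in>{k. 3 * k \<le> n}. finite {j. 2 * j \<le> n - 3 * k}"
      by (intro ballI, rule finite_subset [of _ "{..n}"]) auto
  qed
  also have "\<dots> = (\<Sum>(i, j, k)\<in>triples n. fps_nth (eul 1 1 a) i
        * fps_nth (eul 4 2 b) (2 * j) * fps_nth (coeul 6 3 c) (3 * k))"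
    by (rule sum.reindex_bij_witness [of _ "\<lambda>(i, j, k). (k, j)" "\<lambda>(k, j). (n - 3 * k - 2 * j, j, k)"])
      (auto simp: triples_def)
  finally show ?thesis
    by (simp add: eul_def coeul_def)
qed

definition triple_term :: "nat \<times> nat \<times> nat \<Rightarrow> 'a::field fps" where
  "triple_term = (\<lambda>(i, j, k). (-1) ^ k * fps_X ^ expo i j k
     / (qpoch fps_X fps_X i * qpoch (fps_X ^ 4) (fps_X ^ 4) j * qpoch (fps_X ^ 6) (fps_X ^ 6) k))"

lemma triple_term_eq:
  "triple_term (i, j, k) = (-1) ^ k * fps_X ^ expo i j k
     * inverse (qpoch fps_X fps_X i * qpoch (fps_X ^ 4) (fps_X ^ 4) j * qpoch (fps_X ^ 6) (fps_X ^ 6) k)"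
  using qpoch_nth_0 [of 1 i, where 'a = 'a] qpoch_nth_0 [of 4 j, where 'a = 'a] qpoch_nth_0 [of 6 k, where 'a = 'a]
  by (simp add: triple_term_def fps_divide_unit)

lemma six_choose_2: "6 * (k choose 2) + 3 * k = 3 * k ^ 2"
  by (induction k) (simp_all add: numeral_2_eq_2)

text \<open>Adding 2 n = 2 i + 4 j + 6 k removes the negative term -3 j. The terms 3 i, j, 9 k come
  from the parameters q^3, q, q^9 of \<open>seriesW\<close>, and 6 binom(k,2) from
  \<open>coeul\<close>.\<close>

lemma expo_eq:
  assumes "i + 2 * j + 3 * k = n"
  shows "2 * n + expo i j k = n ^ 2 + (3 * i + j + 9 * k + 6 * (k choose 2))"
proof -
  have "int (2 * n + expo i j k) = int (n ^ 2 + (3 * i + j + 6 * k + (6 * (k choose 2) + 3 * k)))"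
    unfolding six_choose_2 assms [symmetric]
    by (simp add: int_expo power2_eq_square algebra_simps)
  then show ?thesis by linarith
qed

lemma sum_triple_term:
  "fps_X ^ (2 * n) * (\<Sum>t\<in>triples n. triple_term t) = fps_X ^ (n ^ 2) * fps_nth (seriesW :: 'a::field fps fps) n"
proof -
  have "fps_X ^ (2 * n) * triple_term (i, j, k)
      = fps_X ^ (n ^ 2) * ((fps_X ^ 3) ^ i / qpoch fps_X fps_X i * (fps_X ^ j / qpoch (fps_X ^ 4) (fps_X ^ 4) j)
        * ((- (fps_X ^ 9)) ^ k * fps_X ^ (6 * (k choose 2)) / qpoch (fps_X ^ 6) (fps_X ^ 6) k) :: 'a fps)"
    if "i + 2 * j + 3 * k = n" for i j k
  proof -
    have neg: "(- (fps_X ^ 9)) ^ k = (-1) ^ k * (fps_X ^ (9 * k) :: 'a fps)"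
      by (subst power_minus) (simp flip: power_mult)
    have 1: "fps_X ^ (2 * n) * fps_X ^ expo i j k
        = (fps_X ^ (n ^ 2) * (fps_X ^ (3 * i) * fps_X ^ j * fps_X ^ (9 * k) * fps_X ^ (6 * (k choose 2))) :: 'a fps)"
      using expo_eq [OF that] by (simp only: power_add [symmetric])
    have "fps_X ^ (2 * n) * triple_term (i, j, k) = (fps_X ^ (2 * n) * fps_X ^ expo i j k) * ((-1) ^ k
       * inverse (qpoch fps_X fps_X i * qpoch (fps_X ^ 4) (fps_X ^ 4) j * qpoch (fps_X ^ 6) (fps_X ^ 6) k) :: 'a fps)"
      by (simp only: triple_term_eq mult_ac)
    then show ?thesis unfolding 1 neg
      using qpoch_nth_0 [of 1 i, where 'a = 'a] qpoch_nth_0 [of 4 j, where 'a = 'a] qpoch_nth_0 [of 6 k, where 'a = 'a]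
      by (simp add: fps_divide_unit fps_inverse_mult mult_ac flip: power_mult)
  qed
  then show ?thesis
    unfolding seriesW_def eul_eul_coeul_nth sum_distrib_left
    by (intro sum.cong) (auto simp: triples_def)
qed

text \<open>The relation r - E = M_n - M_(n+1) at index n + 1, written without subtraction; the case
  distinction encodes M_0 = 0. It is obtained from \<open>seriesW_nth_Suc\<close> after
  multiplication by q^(2(n+1)), which can be cancelled.\<close>

lemma triple_term_telescope:
  "(\<Sum>t\<in>triples (Suc n). triple_term t) + fps_X ^ (Suc n ^ 2) * fps_nth seriesW n
    = len_gf setE (Suc n)
      + (case n of 0 \<Rightarrow> 0 | Suc m \<Rightarrow> fps_X ^ (n ^ 2) * fps_nth (seriesW :: 'a::field fps fps) m)"
proof -
  let ?W = "fps_nth (seriesW :: 'a fps fps)"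
  let ?r = "\<Sum>t\<in>triples (Suc n). triple_term t :: 'a fps"
  let ?c = "case n of 0 \<Rightarrow> 0 | Suc m \<Rightarrow> fps_X ^ (n ^ 2) * ?W m"
  have shift: "fps_X ^ (2 * Suc n) * ?c = fps_X ^ (Suc n ^ 2) * (case n of 0 \<Rightarrow> 0 | Suc m \<Rightarrow> fps_X * ?W m)"
  proof (cases n)
    case (Suc m)
    have "2 * Suc n + n ^ 2 = Suc n ^ 2 + 1" by (simp add: power2_eq_square)
    then have "fps_X ^ (2 * Suc n) * fps_X ^ (n ^ 2) = fps_X ^ (Suc n ^ 2) * (fps_X :: 'a fps)"
      by (metis power_add power_one_right)
    then have "fps_X ^ (2 * Suc n) * fps_X ^ (n ^ 2) * ?W m = fps_X ^ (Suc n ^ 2) * fps_X * ?W m"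
      by (rule arg_cong)
    moreover have "(case n of 0 \<Rightarrow> 0 | Suc m \<Rightarrow> g m) = g m" for g :: "nat \<Rightarrow> 'a fps"
      by (simp add: Suc)
    ultimately show ?thesis by (simp only: mult.assoc)
  qed simp
  have "fps_X ^ (2 * Suc n) * (?r + fps_X ^ (Suc n ^ 2) * ?W n)
      = fps_X ^ (Suc n ^ 2) * (?W (Suc n) + fps_X ^ (2 * Suc n) * ?W n)"
    unfolding distrib_left sum_triple_term by (simp only: mult_ac)
  also have "\<dots> = fps_X ^ (2 * Suc n) * (len_gf setE (Suc n) + ?c)"
    unfolding seriesW_nth_Suc distrib_left shift len_gf_eq_series by (simp only: mult_ac)
  finally show ?thesis
    by (simp only: mult_cancel_left power_eq_0_iff fps_X_neq_zero simp_thms)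
qed

text \<open>The telescoped form: only the boundary term M_(n+1) survives, and it is divisible by
  q^((n+1)^2).\<close>

lemma sum_triple_term_eq_sum_len_gf:
  "(\<Sum>m\<le>Suc n. \<Sum>t\<in>triples m. triple_term t) + fps_X ^ (Suc n ^ 2) * fps_nth (seriesW :: 'a::field fps fps) n
    = (\<Sum>m\<le>Suc n. len_gf setE m)"
proof (induction n)
  case 0
  have "triples 0 = {(0, 0, 0)}" by (auto simp: triples_def)
  then have "(\<Sum>t\<in>triples 0. triple_term t) = (len_gf setE 0 :: 'a fps)"
    by (simp add: triple_term_def expo_def qpoch_def len_gf_0 setE_def)
  then show ?case using triple_term_telescope [of 0, where 'a = 'a] by (simp add: add_ac)
next
  case (Suc n)
  let ?r = "\<lambda>m. \<Sum>t\<in>triples m. triple_term t :: 'a fps"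
  let ?M = "\<lambda>n. fps_X ^ (Suc n ^ 2) * fps_nth (seriesW :: 'a fps fps) n"
  have "(\<Sum>m\<le>Suc (Suc n). ?r m) + ?M (Suc n) = (\<Sum>m\<le>Suc n. ?r m) + (?r (Suc (Suc n)) + ?M (Suc n))"
    by (simp only: sum.atMost_Suc add.assoc)
  also have "\<dots> = (\<Sum>m\<le>Suc n. ?r m) + (len_gf setE (Suc (Suc n)) + ?M n)"
    by (simp only: triple_term_telescope nat.case)
  also have "\<dots> = ((\<Sum>m\<le>Suc n. ?r m) + ?M n) + len_gf setE (Suc (Suc n))"
    by (simp only: add_ac)
  also have "\<dots> = (\<Sum>m\<le>Suc (Suc n). len_gf setE m)"
    by (simp only: Suc sum.atMost_Suc [of _ "Suc n"])
  finally show ?case .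
qed

section \<open>Convergence of the two infinite sums\<close>

text \<open>Convergence of power series is coefficientwise, and each coefficient of a partial sum is
  constant once the finitely many contributing indices are included.\<close>

lemma has_sum_fpsI:
  fixes f :: "'b \<Rightarrow> 'a::comm_ring_1 fps"
  assumes "\<And>n. finite {x \<in> A. fps_nth (f x) n \<noteq> 0}"
  shows "(f has_sum Abs_fps (\<lambda>n. \<Sum>x | x \<in> A \<and> fps_nth (f x) n \<noteq> 0. fps_nth (f x) n)) A"
  unfolding has_sum_def tendsto_fps_iff eventually_finite_subsets_at_top
proof
  fix n
  let ?S = "{x \<in> A. fps_nth (f x) n \<noteq> 0}"
  have "fps_nth (sum f Y) n = (\<Sum>x\<in>?S. fps_nth (f x) n)" if "finite Y" "?S \<subseteq> Y" "Y \<subseteq> A" for Y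
    using that by (auto simp: fps_sum_nth intro!: sum.mono_neutral_right)
  then show "\<exists>X. finite X \<and> X \<subseteq> A \<and> (\<forall>Y. finite Y \<and> X \<subseteq> Y \<and> Y \<subseteq> A \<longrightarrow>
      fps_nth (sum f Y) n = fps_nth (Abs_fps (\<lambda>n. \<Sum>x | x \<in> A \<and> fps_nth (f x) n \<noteq> 0. fps_nth (f x) n)) n)"
    using assms [of n] by (intro exI [of _ ?S]) auto
qed

text \<open>The successor is necessary: for (i, j, k) = (0, 1, 0) the weight is 2 and the exponent
  1.\<close>

lemma triple_le_expo: "i + 2 * j + 3 * k \<le> Suc (expo i j k)"
proof -
  have "5 * j \<le> 4 * j ^ 2 + 1" by (cases j) (auto simp: power2_eq_square)
  moreover have "k \<le> k ^ 2" by (cases k) (auto simp: power2_eq_square)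
  ultimately show ?thesis unfolding expo_def by linarith
qed

lemma triple_term_nth_nonzero:
  assumes "fps_nth (triple_term (i, j, k) :: 'a::field fps) s \<noteq> 0"
  shows "i + 2 * j + 3 * k \<le> Suc s"
proof -
  note assms
  moreover have "triple_term (i, j, k) = fps_X ^ expo i j k * ((-1) ^ k
     * inverse (qpoch fps_X fps_X i * qpoch (fps_X ^ 4) (fps_X ^ 4) j * qpoch (fps_X ^ 6) (fps_X ^ 6) k) :: 'a fps)"
    by (simp only: triple_term_eq mult_ac)
  ultimately have "expo i j k \<le> s"
    by (auto simp: fps_X_power_mult_nth split: if_splits)
  then show ?thesis using triple_le_expo [of i j k] by linarith
qed

text \<open>Groups the triples by weight; by the bound above, weights beyond s + 1 do not reach the
  coefficient of q^s.\<close>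

lemma has_sum_triple_term:
  "(triple_term has_sum Abs_fps (\<lambda>s. \<Sum>n\<le>Suc s. \<Sum>t\<in>triples n. fps_nth (triple_term t :: 'a::field fps) s)) UNIV"
proof -
  let ?f = "triple_term :: nat \<times> nat \<times> nat \<Rightarrow> 'a fps"
  let ?g = "\<lambda>(i, j, k). i + 2 * j + 3 * k :: nat"
  let ?S = "\<lambda>s. {t \<in> UNIV. fps_nth (?f t) s \<noteq> 0}"
  have g: "?g t \<le> Suc s" if "t \<in> ?S s" for t s
    using that triple_term_nth_nonzero by (cases t) auto
  have fin: "finite (?S s)" for s
  proof (rule finite_subset)
    show "?S s \<subseteq> (\<Union>n\<le>Suc s. triples n)"
      using g by (fastforce simp: triples_def)
  qed (simp add: finite_triples)
  have "(\<Sum>t\<in>?S s. fps_nth (?f t) s) = (\<Sum>n\<le>Suc s. \<Sum>t\<in>triples n. fps_nth (?f t) s)" for s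
  proof -
    have "(\<Sum>t\<in>?S s. fps_nth (?f t) s) = (\<Sum>n\<le>Suc s. \<Sum>t\<in>{t \<in> ?S s. ?g t = n}. fps_nth (?f t) s)"
      using g fin by (intro sum.group [symmetric]) auto
    also have "\<dots> = (\<Sum>n\<le>Suc s. \<Sum>t\<in>triples n. fps_nth (?f t) s)"
      by (rule sum.cong [OF refl], rule sum.mono_neutral_left) (use finite_triples in \<open>auto simp: triples_def\<close>)
    finally show ?thesis .
  qed
  then show ?thesis using has_sum_fpsI [OF fin] by simp
qed

lemma has_sum_setE:
  "((\<lambda>\<pi>. fps_X ^ sum_list \<pi>) has_sum Abs_fps (\<lambda>s. \<Sum>n\<le>Suc s. fps_nth (len_gf setE n :: 'a::field fps) s)) setE"
proof -
  let ?f = "\<lambda>\<pi>. fps_X ^ sum_list \<pi> :: 'a fps"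
  let ?S = "\<lambda>s. {\<pi> \<in> setE. sum_list \<pi> = s}"
  have S: "{\<pi> \<in> setE. fps_nth (?f \<pi>) s \<noteq> 0} = ?S s" for s
    by (auto simp: fps_X_power_nth)
  have len: "length \<pi> \<le> sum_list \<pi>" if "\<pi> \<in> setE" for \<pi>
  proof -
    have "0 \<notin> set \<pi>" using that by (simp add: setE_def adm_0_Cons_iff)
    then show ?thesis by (induction \<pi>) (auto simp: Suc_le_eq)
  qed
  have fin: "finite (?S s)" for s
  proof (rule finite_subset)
    \<comment> \<open>The conjunct \<open>True\<close> gives the sets the shape required by
      \<open>finite_length_sum_list\<close>.\<close>
    show "?S s \<subseteq> (\<Union>n\<le>s. {\<pi>. True \<and> length \<pi> = n \<and> sum_list \<pi> = s})"
      using len by fastforce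
  qed (intro finite_UN_I finite_length_sum_list finite_atMost)
  have eq: "(\<Sum>\<pi>\<in>?S s. fps_nth (?f \<pi>) s) = (\<Sum>n\<le>Suc s. fps_nth (len_gf setE n) s)" for s
  proof -
    have "(\<Sum>\<pi>\<in>?S s. fps_nth (?f \<pi>) s) = (\<Sum>n\<le>Suc s. \<Sum>\<pi>\<in>{\<pi> \<in> ?S s. length \<pi> = n}. fps_nth (?f \<pi>) s)"
      \<comment> \<open>Lengths up to s would suffice; the range up to s + 1 matches that of the
        triple sum.\<close>
      using len fin by (intro sum.group [symmetric]) (auto simp: le_SucI)
    also have "\<dots> = (\<Sum>n\<le>Suc s. fps_nth (len_gf setE n) s)"
      by (intro sum.cong refl) (simp add: len_gf_def conj_ac)
    finally show ?thesis .
  qed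
  have "(?f has_sum Abs_fps (\<lambda>s. \<Sum>\<pi>\<in>?S s. fps_nth (?f \<pi>) s)) setE"
    using has_sum_fpsI [of setE ?f] fin unfolding S .
  then show ?thesis by (simp only: eq)
qed

text \<open>Summability is asserted along with the identity because an infinite sum that does not
  converge has the default value 0.\<close>

theorem mainTheorem3:
  fixes q :: "rat fps"
  defines "q \<equiv> fps_X"
  shows "(\<lambda>\<pi>. q ^ sum_list \<pi>) summable_on P_set \<and>
    (\<lambda>(i, j, k). (-1) ^ k * q ^ expo i j k
        / (qpoch q q i * qpoch (q ^ 4) (q ^ 4) j * qpoch (q ^ 6) (q ^ 6) k)) summable_on UNIV \<and>
    (\<Sum>\<^sub>\<infinity>\<pi>\<in>P_set. q ^ sum_list \<pi>) =
    (\<Sum>\<^sub>\<infinity>(i, j, k)\<in>UNIV. (-1) ^ k * q ^ expo i j k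
        / (qpoch q q i * qpoch (q ^ 4) (q ^ 4) j * qpoch (q ^ 6) (q ^ 6) k))"
proof -
  have "(\<Sum>n\<le>Suc s. \<Sum>t\<in>triples n. fps_nth (triple_term t) s)
      = (\<Sum>n\<le>Suc s. fps_nth (len_gf setE n :: rat fps) s)" for s
  proof -
    \<comment> \<open>The boundary term starts at q^((s+1)^2), beyond the coefficient of q^s, so the
      two truncated sums agree there.\<close>
    have "s < Suc s ^ 2" by (simp add: power2_eq_square)
    then have "fps_nth (fps_X ^ (Suc s ^ 2) * fps_nth (seriesW :: rat fps fps) s) s = 0"
      by (simp only: fps_X_power_mult_nth if_True)
    then show ?thesis
      using arg_cong [where f = "\<lambda>f. fps_nth f s", OF sum_triple_term_eq_sum_len_gf [of s, where 'a = rat]]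
      by (simp only: fps_add_nth fps_sum_nth add_0_right)
  qed
  then have 1: "(triple_term has_sum Abs_fps (\<lambda>s. \<Sum>n\<le>Suc s. fps_nth (len_gf setE n :: rat fps) s)) UNIV"
    using has_sum_triple_term [where 'a = rat] by simp
  have 2: "((\<lambda>\<pi>. q ^ sum_list \<pi>) has_sum Abs_fps (\<lambda>s. \<Sum>n\<le>Suc s. fps_nth (len_gf setE n :: rat fps) s)) P_set"
    unfolding P_set_eq setE_def [symmetric] q_def by (rule has_sum_setE)
  have 3: "(\<lambda>(i, j, k). (-1) ^ k * q ^ expo i j k
        / (qpoch q q i * qpoch (q ^ 4) (q ^ 4) j * qpoch (q ^ 6) (q ^ 6) k)) = triple_term"
    by (simp add: triple_term_def q_def)
  show ?thesis
    unfolding 3 using 1 2 by (auto simp: infsumI dest: has_sum_imp_summable)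
qed

end
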